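(* Let $\Phi:M_n\to M_n$ be an irreducible, positive, trace preserving linear map and let $V$ be a nontrivial subspace of $\mathbb{C}^n$ (i.e. $V\neq\{0\}$ and $V\neq\mathbb{C}^n$). Let $Z$ be the fundamental map of $\Phi$, $K$ the mean hitting time map for $V$, and $D$ its block-diagonal part with respect to $V$. Then for every unit vector $\psi\in V$ and every unit vector $\phi\in V^\perp$, $$\tau(\phi\to V)=\operatorname{Tr}\big((DZ)_{11}\rho_\psi-(DZ)_{12}\rho_\phi\big)=\operatorname{Tr}\big(K_{11}(Z_{11}\rho_\psi-Z_{12}\rho_\phi)\big).$$ In particular, the quantity $\operatorname{Tr}((DZ)_{11}\rho_\psi)$ is independent of the choice of the unit vector $\psi\in V$.
   Context: $M_n=M_n(\mathbb{C})$ is the space of $n\times n$ complex matrices ($n<\infty$), with inner product $\langle B|A\rangle=\operatorname{Tr}(B^*A)$; $I_n$ is the identity matrix and $I$ is the identity map on $M_n$. $\mathbb{C}^n$ carries its standard inner product. Products of linear maps on $M_n$ denote composition, and $\Phi\rho$ means $\Phi(\rho)$. A linear map $\Phi:M_n\to M_n$ is positive if $X\ge 0$ (positive semidefinite) implies $\Phi(X)\ge0$; it is trace preserving if $\operatorname{Tr}(\Phi(X))=\operatorname{Tr}(X)$ for all $X$. A positive map $\Phi$ is irreducible if the only orthogonal projections $P\in M_n$ with $\Phi(PM_nP)\subset PM_nP$ are $P=0$ and $P=I_n$. A density matrix (state) is a positive semidefinite matrix of trace 1. An irreducible positive trace preserving map has a unique invariant state $\pi$ (density matrix with $\Phi(\pi)=\pi$);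 moreover $\pi$ is strictly positive and every fixed point of $\Phi$ in $M_n$ is a scalar multiple of $\pi$. The fundamental map of $\Phi$ is $Z=(I-\Phi+\Omega)^{-1}$, where $\Omega:M_n\to M_n$, $\Omega(X)=\operatorname{Tr}(X)\,\pi$ (this inverse exists). For a unit vector $\phi\in\mathbb{C}^n$ put $\rho_\phi=\phi\phi^*$. Let $P$ be the orthogonal projection of $\mathbb{C}^n$ onto $V$, $Q=I_n-P$, and define maps on $M_n$ by $\mathbb{P}(X)=PXP$, $\mathbb{Q}(X)=QXQ$. The mean hitting time is defined as follows: for a density matrix $\rho$ and $r\ge1$ let $\pi_r(\rho\to V)=\operatorname{Tr}(\mathbb{P}\Phi(\mathbb{Q}\Phi)^{r-1}\rho)$ and $\pi(\rho\to V)=\sum_{r\ge1}\pi_r(\rho\to V)$; then $\tau(\rho\to V)=\sum_{r\ge1}r\,\pi_r(\rho\to V)$ if $\pi(\rho\to V)=1$, and $\tau(\rho\to V)=\infty$ otherwise. For a unit vector $\phi$, $\tau(\phi\to V)=\tau(\rho_\phi\to V)$. The mean hitting time map for $V$ is $K=\Phi(I-\mathbb{Q}\Phi)^{-2}$ (under the assumptions here $I-\mathbb{Q}\Phi$ is invertible). Block notation with respect to $V$: for a linear map $T:M_n\to M_n$, $T_{11}=(I-\mathbb{Q})T(I-\mathbb{Q})$, $T_{12}=(I-\mathbb{Q})T\mathbb{Q}$, $T_{21}=\mathbb{Q}T(I-\mathbb{Q})$, $T_{22}=\mathbb{Q}T\mathbb{Q}$ (all regarded as maps on $M_n$, so $T=T_{11}+T_{12}+T_{21}+T_{22}$).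 The block-diagonal part of $K$ is $D=K_{11}+K_{22}$. *)

theory Defs
  imports "HOL-Analysis.Analysis"
begin

type_synonym 'n cmat = "complex ^ 'n ^ 'n"

text \<open>The library equips \<^typ>\<open>complex ^ 'n\<close> only with its real inner product; the complex one is
  conjugate-linear in the first argument. The library's \<^const>\<open>norm\<close> on \<^typ>\<open>complex ^ 'n\<close> is the
  norm induced by it.\<close>

definition cinner_vec :: "complex ^ 'n \<Rightarrow> complex ^ 'n \<Rightarrow> complex" where
  "cinner_vec x y = (\<Sum>i\<in>UNIV. cnj (x $ i) * y $ i)"

definition ortho_compl :: "(complex ^ 'n) set \<Rightarrow> (complex ^ 'n) set" where
  "ortho_compl V = {x. \<forall>v\<in>V. cinner_vec v x = 0}"

definition hermitian_conj :: "('n::finite) cmat \<Rightarrow> 'n cmat" where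
  "hermitian_conj A = (\<chi> i j. cnj (A $ j $ i))"

definition scale_cmat :: "complex \<Rightarrow> ('n::finite) cmat \<Rightarrow> 'n cmat" where
  "scale_cmat c A = (\<chi> i j. c * A $ i $ j)"

text \<open>Over the complex numbers the condition below already forces \<open>A\<close> to be Hermitian.\<close>

definition pos_semidef :: "('n::finite) cmat \<Rightarrow> bool" where
  "pos_semidef A \<longleftrightarrow> (\<forall>x. cinner_vec x (A *v x) \<in> \<real>\<^sub>\<ge>\<^sub>0)"

definition density_matrix :: "('n::finite) cmat \<Rightarrow> bool" where
  "density_matrix \<rho> \<longleftrightarrow> pos_semidef \<rho> \<and> trace \<rho> = 1"

definition pure_state :: "complex ^ 'n \<Rightarrow> 'n cmat" where
  "pure_state \<phi> = (\<chi> i j. \<phi> $ i * cnj (\<phi> $ j))"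

definition orthogonal_projection :: "('n::finite) cmat \<Rightarrow> bool" where
  "orthogonal_projection P \<longleftrightarrow> hermitian_conj P = P \<and> P ** P = P"

definition proj_onto :: "(complex ^ 'n) set \<Rightarrow> 'n cmat" where
  "proj_onto V = (THE P. orthogonal_projection P \<and> range ((*v) P) = V)"

lemma vector_space_scale_cmat: "vector_space (scale_cmat :: complex \<Rightarrow> ('n::finite) cmat \<Rightarrow> 'n cmat)"
  by unfold_locales (simp_all add: scale_cmat_def vec_eq_iff algebra_simps)

definition linear_cmap :: "(('n::finite) cmat \<Rightarrow> 'n cmat) \<Rightarrow> bool" where
  "linear_cmap \<Phi> \<longleftrightarrow> Vector_Spaces.linear scale_cmat scale_cmat \<Phi>"

definition positive_map :: "(('n::finite) cmat \<Rightarrow> 'n cmat) \<Rightarrow> bool" where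
  "positive_map \<Phi> \<longleftrightarrow> (\<forall>X. pos_semidef X \<longrightarrow> pos_semidef (\<Phi> X))"

definition trace_preserving :: "(('n::finite) cmat \<Rightarrow> 'n cmat) \<Rightarrow> bool" where
  "trace_preserving \<Phi> \<longleftrightarrow> (\<forall>X. trace (\<Phi> X) = trace X)"

definition irreducible_map :: "(('n::finite) cmat \<Rightarrow> 'n cmat) \<Rightarrow> bool" where
  "irreducible_map \<Phi> \<longleftrightarrow>
     (\<forall>P. orthogonal_projection P \<and>
          \<Phi> ` range (\<lambda>X. P ** X ** P) \<subseteq> range (\<lambda>X. P ** X ** P)
        \<longrightarrow> P = 0 \<or> P = mat 1)"

definition invariant_state :: "(('n::finite) cmat \<Rightarrow> 'n cmat) \<Rightarrow> 'n cmat" where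
  "invariant_state \<Phi> = (THE \<pi>. density_matrix \<pi> \<and> \<Phi> \<pi> = \<pi>)"

definition Omega_map :: "(('n::finite) cmat \<Rightarrow> 'n cmat) \<Rightarrow> 'n cmat \<Rightarrow> 'n cmat" where
  "Omega_map \<Phi> X = scale_cmat (trace X) (invariant_state \<Phi>)"

definition fundamental_map :: "(('n::finite) cmat \<Rightarrow> 'n cmat) \<Rightarrow> 'n cmat \<Rightarrow> 'n cmat" where
  "fundamental_map \<Phi> = inv (\<lambda>X. X - \<Phi> X + Omega_map \<Phi> X)"

definition P_map :: "(complex ^ 'n) set \<Rightarrow> 'n cmat \<Rightarrow> 'n cmat" where
  "P_map V X = proj_onto V ** X ** proj_onto V"

definition Q_map :: "(complex ^ 'n) set \<Rightarrow> 'n cmat \<Rightarrow> 'n cmat" where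
  "Q_map V X = (mat 1 - proj_onto V) ** X ** (mat 1 - proj_onto V)"

text \<open>The trace below is a nonnegative real number for positive \<open>\<Phi>\<close> and
  positive semidefinite \<open>\<rho>\<close>; \<^const>\<open>Re\<close> only changes its type.\<close>

definition first_visit_prob ::
  "('n cmat \<Rightarrow> 'n cmat) \<Rightarrow> (complex ^ 'n) set \<Rightarrow> nat \<Rightarrow> 'n cmat \<Rightarrow> real" where
  "first_visit_prob \<Phi> V r \<rho> =
     Re (trace (P_map V (\<Phi> (((Q_map V \<circ> \<Phi>) ^^ (r - 1)) \<rho>))))"

text \<open>The series over \<open>r \<ge> 1\<close> are reindexed by \<^const>\<open>Suc\<close> and taken in the extended reals, where
  a series of nonnegative terms always has a sum.\<close>

definition hitting_prob :: "('n cmat \<Rightarrow> 'n cmat) \<Rightarrow> (complex ^ 'n) set \<Rightarrow> 'n cmat \<Rightarrow> ereal" where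
  "hitting_prob \<Phi> V \<rho> = (\<Sum>r. ereal (first_visit_prob \<Phi> V (Suc r) \<rho>))"

definition mean_hitting_time :: "('n cmat \<Rightarrow> 'n cmat) \<Rightarrow> (complex ^ 'n) set \<Rightarrow> 'n cmat \<Rightarrow> ereal" where
  "mean_hitting_time \<Phi> V \<rho> =
     (if hitting_prob \<Phi> V \<rho> = 1
      then (\<Sum>r. ereal (real (Suc r) * first_visit_prob \<Phi> V (Suc r) \<rho>))
      else \<infinity>)"

definition hitting_time_map :: "('n cmat \<Rightarrow> 'n cmat) \<Rightarrow> (complex ^ 'n) set \<Rightarrow> 'n cmat \<Rightarrow> 'n cmat" where
  "hitting_time_map \<Phi> V = \<Phi> \<circ> (inv (\<lambda>X. X - Q_map V (\<Phi> X)) ^^ 2)"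

text \<open>Note that \<open>I - Q_map V\<close> is not the map \<^const>\<open>P_map\<close>: it also keeps the off-diagonal
  corners \<open>P X Q\<close> and \<open>Q X P\<close>.\<close>

definition compl_Q_map :: "(complex ^ 'n) set \<Rightarrow> 'n cmat \<Rightarrow> 'n cmat" where
  "compl_Q_map V X = X - Q_map V X"

definition block11 :: "(complex ^ 'n) set \<Rightarrow> ('n cmat \<Rightarrow> 'n cmat) \<Rightarrow> 'n cmat \<Rightarrow> 'n cmat" where
  "block11 V T = compl_Q_map V \<circ> T \<circ> compl_Q_map V"

definition block12 :: "(complex ^ 'n) set \<Rightarrow> ('n cmat \<Rightarrow> 'n cmat) \<Rightarrow> 'n cmat \<Rightarrow> 'n cmat" where
  "block12 V T = compl_Q_map V \<circ> T \<circ> Q_map V"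

definition block22 :: "(complex ^ 'n) set \<Rightarrow> ('n cmat \<Rightarrow> 'n cmat) \<Rightarrow> 'n cmat \<Rightarrow> 'n cmat" where
  "block22 V T = Q_map V \<circ> T \<circ> Q_map V"

definition block_diag :: "(complex ^ 'n) set \<Rightarrow> ('n cmat \<Rightarrow> 'n cmat) \<Rightarrow> 'n cmat \<Rightarrow> 'n cmat" where
  "block_diag V T X = block11 V T X + block22 V T X"

end

(* Writing T = Q Phi and G = (I - T)^{-1}, trace preservation turns the trace of (I - Q) K X into
   k(X) = Tr(G X), which is the expected number of steps before absorption and satisfies
   k(Q Phi X) = k(X) - Tr X. Splitting k = k1 + k2 along I = (I - Q) + Q gives
   k2 (I - Phi) = Tr - k1; composing with Z, for which (I - Phi) Z = I - Omega, yields
   k2(X) - Tr(X) k2(pi) = Tr(X) - k1(Z X). Comparing a state on V, where k2 vanishes, with a state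
   on the orthogonal complement gives the formula.

   Existence of pi is Brouwer's theorem on the density matrices. Brouwer also gives invertibility of
   I - T: if X is a Hermitian fixed point of T, then T maps the compact convex set of positive
   semidefinite Y with X <= Y and bounded trace into itself; by irreducibility the only positive
   semidefinite fixed point of T is 0, so X <= 0, and likewise -X <= 0. *)

theory Submission imports Defs begin

section \<open>Positive semidefinite matrices\<close>

text \<open>Lets positivity be studied through the real inner product, for which orthogonal
  decompositions and continuity are at hand.\<close>

lemma inner_eq_Re_cinner: "x \<bullet> y = Re (cinner_vec x y)"
  by (simp add: cinner_vec_def inner_vec_def inner_complex_def)

lemma cinner_add_left: "cinner_vec (x + y) z = cinner_vec x z + cinner_vec y z"
  and cinner_add_right: "cinner_vec z (x + y) = cinner_vec z x + cinner_vec z y"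
  and cinner_scale_left: "cinner_vec (c *s x) z = cnj c * cinner_vec x z"
  and cinner_scale_right: "cinner_vec z (c *s x) = c * cinner_vec z x"
  by (simp_all add: cinner_vec_def sum.distrib sum_distrib_left algebra_simps)

lemma cinner_commute: "cinner_vec y x = cnj (cinner_vec x y)"
  by (simp add: cinner_vec_def mult.commute)

lemma cinner_self: "cinner_vec x x = complex_of_real ((norm x)\<^sup>2)"
proof -
  have "Re (cinner_vec x x) = (norm x)\<^sup>2"
    by (simp flip: inner_eq_Re_cinner add: power2_norm_eq_inner)
  moreover have "Im (cinner_vec x x) = 0"
    using cinner_commute[of x x] by (simp add: complex_eq_iff)
  ultimately show ?thesis by (simp add: complex_eq_iff)
qed

lemma cinner_matrix_left:
  "cinner_vec (A *v x) y = cinner_vec x (hermitian_conj A *v y)"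
  by (simp add: cinner_vec_def hermitian_conj_def matrix_vector_mult_def sum_distrib_left
      sum_distrib_right) (subst sum.swap, simp add: algebra_simps)

lemma inner_matrix_left: "(A *v x) \<bullet> y = x \<bullet> (hermitian_conj A *v y)"
  by (simp add: inner_eq_Re_cinner cinner_matrix_left)

lemma cinner_axis: "cinner_vec (axis i 1) (A *v axis j 1) = A $ i $ j"
  by (simp add: cinner_vec_def axis_def matrix_vector_mult_def if_distrib[of cnj]
      if_distrib[of "\<lambda>z. _ * z"] if_distrib[of "\<lambda>z. z * _"] cong: if_cong)

lemma hermitian_conj_add: "hermitian_conj (A + B) = hermitian_conj A + hermitian_conj B"
  and hermitian_conj_diff: "hermitian_conj (A - B) = hermitian_conj A - hermitian_conj B"
  and hermitian_conj_uminus: "hermitian_conj (- A) = - hermitian_conj A"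
  and hermitian_conj_scale: "hermitian_conj (scale_cmat c A) = scale_cmat (cnj c) (hermitian_conj A)"
  and hermitian_conj_zero: "hermitian_conj 0 = 0"
  and hermitian_conj_id: "hermitian_conj (hermitian_conj A) = A"
  and hermitian_conj_scaleR: "hermitian_conj (r *\<^sub>R A) = r *\<^sub>R hermitian_conj A"
  by (simp_all add: hermitian_conj_def vec_eq_iff scale_cmat_def)

lemma hermitian_conj_mat_1: "hermitian_conj (mat 1) = mat 1"
  by (simp add: hermitian_conj_def vec_eq_iff mat_def)

lemma hermitian_conj_mult: "hermitian_conj (A ** B) = hermitian_conj B ** hermitian_conj A"
  by (simp add: hermitian_conj_def vec_eq_iff matrix_matrix_mult_def mult.commute)

lemmas hermitian_conj_simps = hermitian_conj_add hermitian_conj_diff hermitian_conj_uminus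
  hermitian_conj_scale hermitian_conj_zero hermitian_conj_id hermitian_conj_scaleR
  hermitian_conj_mat_1 hermitian_conj_mult

lemma scaleR_eq_scale_cmat: "r *\<^sub>R A = scale_cmat (complex_of_real r) A"
  by (simp add: scale_cmat_def vec_eq_iff scaleR_conv_of_real[where 'a = complex])

lemma scale_cmat_mult_left: "scale_cmat c A ** B = scale_cmat c (A ** B)"
  and scale_cmat_mult_right: "A ** scale_cmat c B = scale_cmat c (A ** B)"
  by (simp_all add: scale_cmat_def matrix_matrix_mult_def vec_eq_iff sum_distrib_left algebra_simps)

lemma scale_cmat_distribs:
  "scale_cmat c (A + B) = scale_cmat c A + scale_cmat c B"
  "scale_cmat c (A - B) = scale_cmat c A - scale_cmat c B"
  "scale_cmat c (scale_cmat d A) = scale_cmat (c * d) A"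
  "scale_cmat 1 A = A" "scale_cmat 0 A = 0" "scale_cmat c 0 = 0"
  "scale_cmat (-1) A = - A"
  by (simp_all add: scale_cmat_def vec_eq_iff algebra_simps)

lemma matrix_mult_diff_left: "(A - B) ** C = A ** C - B ** (C :: ('n::finite) cmat)"
  and matrix_mult_diff_right: "C ** (A - B) = C ** A - C ** (B :: ('n::finite) cmat)"
  by (simp_all add: matrix_matrix_mult_def vec_eq_iff algebra_simps sum_subtractf)

lemma matrix_mult_add_left: "(A + B) ** C = A ** C + B ** (C :: ('n::finite) cmat)"
  by (simp add: matrix_matrix_mult_def vec_eq_iff algebra_simps sum.distrib)

lemma trace_scale_cmat: "trace (scale_cmat c A) = c * trace A"
  by (simp add: trace_def scale_cmat_def sum_distrib_left)

lemma trace_hermitian_conj: "trace (hermitian_conj A) = cnj (trace A)"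
  by (simp add: trace_def hermitian_conj_def)

text \<open>Polarization: reality of the form at x + y controls the imaginary parts of its mixed
  values, reality at x + iy the real parts.\<close>

lemma pos_semidef_hermitian:
  assumes "pos_semidef A"
  shows "hermitian_conj A = A"
proof -
  let ?B = "\<lambda>x y. cinner_vec x (A *v y)"
  have im: "Im (?B x x) = 0" for x
    using assms by (simp add: pos_semidef_def complex_nonneg_Reals_iff)
  have "?B y x = cnj (?B x y)" for x y
  proof -
    have "Im (?B (x + y) (x + y)) = 0" "Im (?B (x + \<i> *s y) (x + \<i> *s y)) = 0"
      using im by blast+
    then show ?thesis
      by (simp add: matrix_vector_right_distrib cinner_add_left cinner_add_right im vector_scalar_commute
          cinner_scale_left cinner_scale_right complex_eq_iff)
  qed
  from this[of "axis j 1" "axis i 1" for i j] have "cnj (A $ j $ i) = A $ i $ j" for i j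
    unfolding cinner_axis by (rule sym)
  then show ?thesis
    by (simp only: vec_eq_iff hermitian_conj_def vec_lambda_beta) blast
qed

text \<open>Trades the complex condition for an equation and real inequalities, from which
  closedness of the cone can be read off.\<close>

lemma pos_semidef_iff:
  "pos_semidef A \<longleftrightarrow> hermitian_conj A = A \<and> (\<forall>x. 0 \<le> x \<bullet> (A *v x))"
proof (intro iffI conjI)
  assume h: "hermitian_conj A = A \<and> (\<forall>x. 0 \<le> x \<bullet> (A *v x))"
  have "cnj (cinner_vec x (A *v x)) = cinner_vec x (A *v x)" for x
    using h cinner_commute[of "A *v x" x] cinner_matrix_left[of A x x] by simp
  then have "Im (cinner_vec x (A *v x)) = 0" for x
    by (metis complex_cnj_cancel_iff complex_is_Real_iff Reals_cnj_iff)
  with h show "pos_semidef A"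
    by (auto simp: pos_semidef_def complex_nonneg_Reals_iff inner_eq_Re_cinner)
qed (auto simp: pos_semidef_hermitian pos_semidef_def complex_nonneg_Reals_iff inner_eq_Re_cinner)

lemma pos_semidef_nonneg: "pos_semidef A \<Longrightarrow> 0 \<le> x \<bullet> (A *v x)"
  by (simp add: pos_semidef_iff)

lemma scaleR_matrix_vector: "(r *\<^sub>R A) *v x = r *\<^sub>R (A *v (x :: complex ^ 'n::finite))"
  and matrix_vector_scaleR: "A *v (r *\<^sub>R x) = r *\<^sub>R (A *v (x :: complex ^ 'n::finite))"
  by (simp_all add: vec_eq_iff matrix_vector_mult_def scaleR_sum_right)

lemma pos_semidef_add: "pos_semidef A \<Longrightarrow> pos_semidef B \<Longrightarrow> pos_semidef (A + B)"
  by (simp add: pos_semidef_iff hermitian_conj_simps matrix_vector_mult_add_rdistrib inner_add_right)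

lemma pos_semidef_scaleR: "0 \<le> r \<Longrightarrow> pos_semidef A \<Longrightarrow> pos_semidef (r *\<^sub>R A)"
  by (simp add: pos_semidef_iff hermitian_conj_simps scaleR_matrix_vector)

lemma pos_semidef_mat_1: "pos_semidef (mat 1)"
  by (simp add: pos_semidef_iff hermitian_conj_simps)

lemma pos_semidef_congruence:
  assumes "pos_semidef A"
  shows "pos_semidef (hermitian_conj B ** A ** B)"
proof -
  have "x \<bullet> ((hermitian_conj B ** A ** B) *v x) = (B *v x) \<bullet> (A *v (B *v x))" for x
    by (simp only: inner_matrix_left matrix_vector_mul_assoc matrix_mul_assoc)
  moreover have "hermitian_conj (hermitian_conj B ** A ** B) = hermitian_conj B ** A ** B"
    unfolding hermitian_conj_mult hermitian_conj_id pos_semidef_hermitian[OF assms]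
    by (rule matrix_mul_assoc)
  ultimately show ?thesis
    unfolding pos_semidef_iff using pos_semidef_nonneg[OF assms] by presburger
qed

text \<open>If y = Ax were nonzero, moving from x a little in the direction -y would make the
  quadratic form negative, because its first order term is -2t times the square of the norm of
  y.\<close>

lemma pos_semidef_kernel:
  assumes A: "pos_semidef A" and x: "x \<bullet> (A *v x) = 0"
  shows "A *v x = 0"
proof (rule ccontr)
  let ?y = "A *v x" and ?q = "(A *v x) \<bullet> (A *v (A *v x))"
  assume "?y \<noteq> 0"
  then have n: "?y \<bullet> ?y > 0" by simp
  have q: "?q \<ge> 0" using A by (rule pos_semidef_nonneg)
  \<comment> \<open>Small enough that t times \<open>?q\<close> is at most the squared norm of y;
    the summand 1 keeps the denominator positive when \<open>?q\<close> is 0.\<close>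
  define t where "t = (?y \<bullet> ?y) / (?q + 1)"
  have t: "t > 0" using n q by (simp add: t_def)
  have h: "x \<bullet> (A *v ?y) = ?y \<bullet> ?y"
    using inner_matrix_left[of A x ?y] pos_semidef_hermitian[OF A] by simp
  have "0 \<le> (x - t *\<^sub>R ?y) \<bullet> (A *v (x - t *\<^sub>R ?y))"
    using A by (rule pos_semidef_nonneg)
  also have "\<dots> = t * (t * ?q - 2 * (?y \<bullet> ?y))"
    unfolding matrix_vector_mult_diff_distrib matrix_vector_scaleR inner_diff_left
      inner_diff_right inner_scaleR_left inner_scaleR_right x h
    by (simp add: algebra_simps)
  finally have "2 * (?y \<bullet> ?y) \<le> t * ?q" using t by (simp add: zero_le_mult_iff)
  also have "\<dots> \<le> ?y \<bullet> ?y" using n q by (simp add: t_def field_simps)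
  finally show False using n by simp
qed

lemma Re_trace: "Re (trace A) = (\<Sum>i\<in>UNIV. axis i 1 \<bullet> (A *v axis i 1))"
  by (simp add: trace_def inner_eq_Re_cinner cinner_axis)

lemma pos_semidef_trace_nonneg: "pos_semidef A \<Longrightarrow> 0 \<le> Re (trace A)"
  unfolding Re_trace by (intro sum_nonneg pos_semidef_nonneg)

lemma pos_semidef_trace_eq_0:
  assumes A: "pos_semidef A" and "Re (trace A) = 0"
  shows "A = 0"
proof -
  have "(\<Sum>i\<in>UNIV. axis i 1 \<bullet> (A *v axis i 1)) = 0"
    using assms(2) by (simp only: Re_trace)
  then have "axis i 1 \<bullet> (A *v axis i 1) = 0" for i
    by (simp add: sum_nonneg_eq_0_iff pos_semidef_nonneg[OF A])
  then have "A *v axis i 1 = 0" for i by (rule pos_semidef_kernel[OF A])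
  then have "A $ i $ j = 0" for i j using cinner_axis[of i A j] by (simp add: cinner_vec_def)
  then show ?thesis by (simp add: vec_eq_iff)
qed

section \<open>Topology of the positive semidefinite cone\<close>

lemma continuous_on_matrix_vector [continuous_intros]:
  fixes f :: "'a::topological_space \<Rightarrow> ('n::finite) cmat"
  assumes "continuous_on S f" "continuous_on S g"
  shows "continuous_on S (\<lambda>z. f z *v g z)"
  unfolding matrix_vector_mult_def using assms
  by (intro continuous_on_vec_lambda continuous_intros)

lemma continuous_on_trace [continuous_intros]:
  fixes f :: "'a::topological_space \<Rightarrow> ('n::finite) cmat"
  assumes "continuous_on S f"
  shows "continuous_on S (\<lambda>z. trace (f z))"
  unfolding trace_def using assms by (intro continuous_intros)

lemma continuous_on_hermitian_conj [continuous_intros]: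
  assumes "continuous_on S f"
  shows "continuous_on S (\<lambda>z. hermitian_conj (f z))"
  unfolding hermitian_conj_def using assms
  by (intro continuous_on_vec_lambda continuous_intros)

lemma closed_pos_semidef: "closed {A :: ('n::finite) cmat. pos_semidef A}"
  unfolding pos_semidef_iff
  by (intro closed_Collect_conj closed_Collect_all closed_Collect_eq closed_Collect_le
      continuous_intros)

lemma convex_pos_semidef: "convex {A :: ('n::finite) cmat. pos_semidef A}"
  by (auto simp: convex_def intro: pos_semidef_add pos_semidef_scaleR)

lemma trace_scaleR: "trace (r *\<^sub>R A) = complex_of_real r * trace A"
  for A :: "('n::finite) cmat"
  by (simp add: scaleR_eq_scale_cmat trace_scale_cmat)

text \<open>On the compact set of positive semidefinite matrices of norm 1 the trace attains a
  positive minimum m; scaling gives the bound with c = 1/m.\<close>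

lemma pos_semidef_norm_le_trace:
  obtains c where "c > 0" "\<And>A :: ('n::finite) cmat. pos_semidef A \<Longrightarrow> norm A \<le> c * Re (trace A)"
proof -
  let ?S = "sphere (0 :: 'n cmat) 1 \<inter> {A. pos_semidef A}"
  have "compact ?S" by (intro compact_Int_closed compact_sphere closed_pos_semidef)
  moreover have "(1 / norm (mat 1 :: 'n cmat)) *\<^sub>R mat 1 \<in> ?S"
  proof -
    have "(mat 1 :: 'n cmat) \<noteq> 0" by (simp add: mat_def vec_eq_iff)
    then show ?thesis by (auto intro: pos_semidef_scaleR pos_semidef_mat_1)
  qed
  then have "?S \<noteq> {}" by blast
  moreover have "continuous_on ?S (\<lambda>A. Re (trace A))" by (intro continuous_intros)
  ultimately obtain A0 where A0: "A0 \<in> ?S" "\<And>A. A \<in> ?S \<Longrightarrow> Re (trace A0) \<le> Re (trace A)"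
    using continuous_attains_inf by metis
  define m where "m = Re (trace A0)"
  have "m \<noteq> 0" using A0(1) pos_semidef_trace_eq_0[of A0] by (auto simp: m_def)
  then have m: "m > 0" using A0(1) pos_semidef_trace_nonneg[of A0] by (auto simp: m_def)
  have "norm A \<le> (1 / m) * Re (trace A)" if A: "pos_semidef A" for A :: "'n cmat"
  proof (cases "A = 0")
    case False
    then have "(1 / norm A) *\<^sub>R A \<in> ?S" using A by (auto intro: pos_semidef_scaleR)
    from A0(2)[OF this] have "m \<le> Re (trace A) / norm A" by (simp add: trace_scaleR m_def)
    then show ?thesis using m False by (simp add: field_simps)
  qed (simp add: trace_def)
  then show ?thesis using m that by (metis zero_less_divide_1_iff)
qed

section \<open>Positive linear maps\<close>

lemma linear_cmap_iff:
  "linear_cmap \<Phi> \<longleftrightarrow>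
     (\<forall>X Y. \<Phi> (X + Y) = \<Phi> X + \<Phi> Y) \<and> (\<forall>c X. \<Phi> (scale_cmat c X) = scale_cmat c (\<Phi> X))"
  unfolding linear_cmap_def Vector_Spaces.linear_iff using vector_space_scale_cmat by blast

lemma linear_cmap_add: "linear_cmap \<Phi> \<Longrightarrow> \<Phi> (X + Y) = \<Phi> X + \<Phi> Y"
  and linear_cmap_scale: "linear_cmap \<Phi> \<Longrightarrow> \<Phi> (scale_cmat c X) = scale_cmat c (\<Phi> X)"
  by (simp_all add: linear_cmap_iff)

lemma linear_cmap_imp_linear: "linear_cmap \<Phi> \<Longrightarrow> linear \<Phi>"
  by (auto simp: linear_cmap_iff scaleR_eq_scale_cmat intro!: linearI)

lemma linear_cmap_diff: "linear_cmap \<Phi> \<Longrightarrow> \<Phi> (X - Y) = \<Phi> X - \<Phi> Y"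
  by (rule linear_diff[OF linear_cmap_imp_linear])

text \<open>On the orthogonal complement of its kernel Y is positive definite, so there the quotient
  of the two quadratic forms is bounded by compactness. The case Y = I bounds any Hermitian matrix;
  a fixed point in the role of Y serves the irreducibility argument.\<close>

lemma pos_semidef_dominates:
  fixes X Y :: "('n::finite) cmat"
  assumes Y: "pos_semidef Y" and X: "hermitian_conj X = X"
    and ker: "\<And>x. Y *v x = 0 \<Longrightarrow> X *v x = 0"
  obtains c where "c \<ge> 0" "pos_semidef (c *\<^sub>R Y - X)"
proof -
  define N where "N = {x. Y *v x = 0}"
  have "subspace N"
    by (auto simp: N_def subspace_def matrix_vector_right_distrib matrix_vector_scaleR)
  then have span_N: "span N = N" by (rule span_eq_iff[THEN iffD2])
  let ?S = "sphere 0 1 \<inter> {y. \<forall>w\<in>N. y \<bullet> w = 0}"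
  have Y_pos: "y \<bullet> (Y *v y) > 0" if "y \<in> ?S" for y
  proof (rule ccontr)
    assume "\<not> ?thesis"
    with pos_semidef_nonneg[OF Y, of y] have "y \<bullet> (Y *v y) = 0" by simp
    then have "y \<in> N" unfolding N_def using pos_semidef_kernel[OF Y] by blast
    with that show False by auto
  qed
  have "closed (\<Inter>w\<in>N. {y :: complex ^ 'n. y \<bullet> w = 0})"
    by (intro closed_INT ballI closed_Collect_eq continuous_intros)
  also have "(\<Inter>w\<in>N. {y. y \<bullet> w = 0}) = {y. \<forall>w\<in>N. y \<bullet> w = 0}" by blast
  finally have "closed {y :: complex ^ 'n. \<forall>w\<in>N. y \<bullet> w = 0}" .
  then have "compact ?S" by (intro compact_Int_closed compact_sphere)
  moreover have "continuous_on ?S (\<lambda>y. (y \<bullet> (X *v y)) / (y \<bullet> (Y *v y)))"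
    using Y_pos by (intro continuous_intros) force
  \<comment> \<open>Boundedness is used instead of an attained maximum because \<open>?S\<close> is
    empty when Y = 0.\<close>
  ultimately have "bounded ((\<lambda>y. (y \<bullet> (X *v y)) / (y \<bullet> (Y *v y))) ` ?S)"
    by (intro compact_imp_bounded compact_continuous_image)
  then obtain c where c: "c > 0" "\<And>y. y \<in> ?S \<Longrightarrow> \<bar>(y \<bullet> (X *v y)) / (y \<bullet> (Y *v y))\<bar> \<le> c"
    unfolding bounded_pos by force
  have "0 \<le> x \<bullet> ((c *\<^sub>R Y - X) *v x)" for x
  proof -
    obtain n y where n: "n \<in> N" and y: "\<And>w. w \<in> N \<Longrightarrow> orthogonal y w" and x: "x = n + y"
      using orthogonal_subspace_decomp_exists[of N x] span_N by metis
    \<comment> \<open>Cross terms vanish since A is Hermitian and annihilates n; this applies to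
      both forms at once through \<open>c *\<^sub>R Y - X\<close>.\<close>
    have 0: "(n + y) \<bullet> (A *v (n + y)) = y \<bullet> (A *v y)"
      if "hermitian_conj A = A" "A *v n = 0" for A
      using that inner_matrix_left[of A n y]
      by (simp add: matrix_vector_right_distrib inner_add_left)
    have "y \<bullet> (X *v y) \<le> c * (y \<bullet> (Y *v y))"
    proof (cases "y = 0")
      case False
      let ?u = "(1 / norm y) *\<^sub>R y"
      have u: "?u \<in> ?S" using y False by (auto simp: orthogonal_def)
      have "?u \<bullet> (X *v ?u) \<le> c * (?u \<bullet> (Y *v ?u))"
        using abs_le_D1[OF c(2)[OF u]] Y_pos[OF u] by (simp only: pos_divide_le_eq)
      moreover have "?u \<bullet> (A *v ?u) = (y \<bullet> (A *v y)) / (norm y)\<^sup>2" for A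
        unfolding matrix_vector_scaleR inner_scaleR_left inner_scaleR_right
        by (simp add: power2_eq_square)
      ultimately have "(y \<bullet> (X *v y)) / (norm y)\<^sup>2 \<le> (c * (y \<bullet> (Y *v y))) / (norm y)\<^sup>2"
        by (simp only: times_divide_eq_right)
      then show ?thesis using False by (subst (asm) divide_le_cancel) auto
    qed simp
    then have "0 \<le> y \<bullet> ((c *\<^sub>R Y - X) *v y)"
      by (simp add: matrix_vector_mult_diff_rdistrib scaleR_matrix_vector inner_diff_right)
    moreover have "(c *\<^sub>R Y - X) *v n = 0"
      using n ker[of n]
      by (simp add: matrix_vector_mult_diff_rdistrib scaleR_matrix_vector N_def)
    moreover have "hermitian_conj (c *\<^sub>R Y - X) = c *\<^sub>R Y - X"
      by (simp add: hermitian_conj_simps X pos_semidef_hermitian[OF Y])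
    ultimately show ?thesis unfolding x by (simp only: 0)
  qed
  then have "pos_semidef (c *\<^sub>R Y - X)"
    by (simp add: pos_semidef_iff hermitian_conj_simps X pos_semidef_hermitian[OF Y])
  with c(1) that show ?thesis by (meson less_imp_le)
qed

lemma hermitian_decomposition:
  obtains H1 H2 where "hermitian_conj H1 = H1" "hermitian_conj H2 = H2" "X = H1 + scale_cmat \<i> H2"
proof
  let ?H1 = "scale_cmat (1/2) (X + hermitian_conj X)"
  let ?H2 = "scale_cmat (-\<i>/2) (X - hermitian_conj X)"
  show "hermitian_conj ?H1 = ?H1" by (simp add: hermitian_conj_simps add.commute)
  show "hermitian_conj ?H2 = ?H2"
    by (simp add: hermitian_conj_simps) (simp add: scale_cmat_def vec_eq_iff algebra_simps)
  show "X = ?H1 + scale_cmat \<i> ?H2"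
    by (simp add: scale_cmat_def vec_eq_iff field_simps)
qed

text \<open>An induction principle: the positive semidefinite matrices span the whole space over the
  complex numbers, since a Hermitian H is cI - (cI - H) for large c.\<close>

lemma pos_semidef_spanning:
  fixes X :: "('n::finite) cmat"
  assumes add: "\<And>X Y. S X \<Longrightarrow> S Y \<Longrightarrow> S (X + Y)"
    and scale: "\<And>c X. S X \<Longrightarrow> S (scale_cmat c X)"
    and psd: "\<And>X. pos_semidef X \<Longrightarrow> S X"
  shows "S X"
proof -
  have herm: "S H" if H: "hermitian_conj H = H" for H
  proof -
    obtain c where c: "c \<ge> 0" "pos_semidef (c *\<^sub>R mat 1 - H)"
      using pos_semidef_dominates[OF pos_semidef_mat_1 H] by auto
    have "S (c *\<^sub>R mat 1 + scale_cmat (-1) (c *\<^sub>R mat 1 - H))"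
      using c by (intro add scale psd pos_semidef_scaleR pos_semidef_mat_1)
    then show ?thesis by (simp add: scale_cmat_distribs)
  qed
  obtain H1 H2 where "hermitian_conj H1 = H1" "hermitian_conj H2 = H2" "X = H1 + scale_cmat \<i> H2"
    using hermitian_decomposition .
  then show ?thesis using add scale herm by simp
qed

text \<open>Both sides are conjugate-linear in X, so the spanning principle reduces the claim to
  positive semidefinite X, where X and its image are both Hermitian.\<close>

lemma positive_map_hermitian_conj:
  assumes "linear_cmap \<Phi>" "positive_map \<Phi>"
  shows "\<Phi> (hermitian_conj X) = hermitian_conj (\<Phi> X)"
proof (rule pos_semidef_spanning[where X = X])
  fix X :: "'a cmat" assume "pos_semidef X"
  then show "\<Phi> (hermitian_conj X) = hermitian_conj (\<Phi> X)"
    using assms(2) by (simp add: positive_map_def pos_semidef_hermitian)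
qed (simp_all add: hermitian_conj_simps linear_cmap_add[OF assms(1)] linear_cmap_scale[OF assms(1)])

lemma bij_cmapI:
  assumes L: "linear_cmap L"
    and herm: "\<And>X. L (hermitian_conj X) = hermitian_conj (L X)"
    and ker: "\<And>H. hermitian_conj H = H \<Longrightarrow> L H = 0 \<Longrightarrow> H = 0"
  shows "bij L"
proof -
  have lin: "linear L" using L by (rule linear_cmap_imp_linear)
  have "X = 0" if X: "L X = 0" for X
  proof -
    have "X + hermitian_conj X = 0"
    proof (rule ker)
      show "L (X + hermitian_conj X) = 0"
        using X by (simp add: linear_cmap_add[OF L] herm hermitian_conj_simps)
    qed (simp add: hermitian_conj_simps add.commute)
    moreover have "scale_cmat \<i> (X - hermitian_conj X) = 0"
    proof (rule ker)
      show "hermitian_conj (scale_cmat \<i> (X - hermitian_conj X)) = scale_cmat \<i> (X - hermitian_conj X)"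
        by (simp add: hermitian_conj_simps) (simp add: scale_cmat_def vec_eq_iff algebra_simps)
      show "L (scale_cmat \<i> (X - hermitian_conj X)) = 0"
        using X by (simp add: linear_cmap_scale[OF L] linear_cmap_diff[OF L] herm
            hermitian_conj_simps scale_cmat_distribs)
    qed
    then have "X - hermitian_conj X = 0" by (simp add: scale_cmat_def vec_eq_iff)
    ultimately show "X = 0" by (simp add: vec_eq_iff)
  qed
  then have "inj L" using lin by (simp add: linear_injective_0)
  then show ?thesis using lin linear_injective_imp_surjective by (auto simp: bij_def)
qed

section \<open>Orthogonal projections\<close>

lemma orthogonal_projection_exists:
  fixes V :: "(complex ^ 'n::finite) set"
  assumes V: "vec.subspace V"
  shows "\<exists>P. orthogonal_projection P \<and> range ((*v) P) = V"
proof -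
  have scaleR: "r *\<^sub>R x = complex_of_real r *s x" for r and x :: "complex ^ 'n"
    by (simp add: vec_eq_iff scaleR_conv_of_real[where 'a = complex])
  have V0: "0 \<in> V" and Vadd: "x \<in> V \<Longrightarrow> y \<in> V \<Longrightarrow> x + y \<in> V" and Vs: "x \<in> V \<Longrightarrow> c *s x \<in> V"
    for x y c using V by (simp_all add: vec.subspace_def)
  have "subspace V" by (auto simp: subspace_def V0 Vadd Vs scaleR)
  then have span_V: "span V = V" by (rule span_eq_iff[THEN iffD2])
  have "\<exists>y. y \<in> V \<and> x - y \<in> ortho_compl V" for x
  proof -
    obtain y z where y: "y \<in> V" and z: "\<And>w. w \<in> V \<Longrightarrow> orthogonal z w" and x: "x = y + z"
      using orthogonal_subspace_decomp_exists[of V x] span_V by metis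
    \<comment> \<open>Real orthogonality to both w and iw, which lie in the complex subspace V,
      amounts to complex orthogonality.\<close>
    have "cinner_vec w z = 0" if w: "w \<in> V" for w
    proof -
      have "Re (cinner_vec w z) = 0" "Re (cinner_vec (\<i> *s w) z) = 0"
        using z[OF w] z[OF Vs[OF w]] by (simp_all add: orthogonal_def inner_commute flip: inner_eq_Re_cinner)
      then show ?thesis by (simp add: cinner_scale_left complex_eq_iff)
    qed
    with x y show ?thesis by (auto simp: ortho_compl_def)
  qed
  then obtain p where p: "\<And>x. p x \<in> V" "\<And>x. x - p x \<in> ortho_compl V" by metis
  have O: "x \<in> ortho_compl V \<Longrightarrow> y \<in> ortho_compl V \<Longrightarrow> x + y \<in> ortho_compl V"
    "x \<in> ortho_compl V \<Longrightarrow> c *s x \<in> ortho_compl V" for x y c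
    by (simp_all add: ortho_compl_def cinner_add_right cinner_scale_right)
  \<comment> \<open>Uniqueness of the decomposition is what makes p complex linear, hence given by a
    matrix.\<close>
  have uniq: "p x = y" if y: "y \<in> V" "x - y \<in> ortho_compl V" for x y
  proof -
    have a: "p x + (-1) *s y \<in> V" using p y by (intro Vadd Vs)
    have "(x - y) + (-1) *s (x - p x) \<in> ortho_compl V" using p y by (intro O)
    then have "p x - y \<in> ortho_compl V" by (simp add: algebra_simps vec_eq_iff)
    with a have "cinner_vec (p x - y) (p x - y) = 0"
      by (simp add: ortho_compl_def)
    then show ?thesis by (simp add: cinner_self)
  qed
  have "Vector_Spaces.linear (*s) (*s) p"
  proof (unfold Vector_Spaces.linear_iff, intro conjI allI)
    show "p (x + y) = p x + p y" for x y
    proof (rule uniq)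
      have "(x - p x) + (y - p y) \<in> ortho_compl V" using p by (intro O)
      then show "x + y - (p x + p y) \<in> ortho_compl V" by (simp add: algebra_simps)
    qed (intro Vadd p)
    show "p (c *s x) = c *s p x" for c x
    proof (rule uniq)
      have "c *s (x - p x) \<in> ortho_compl V" using p by (intro O)
      then show "c *s x - c *s p x \<in> ortho_compl V" by (simp add: vector_ssub_ldistrib)
    qed (intro Vs p)
  qed unfold_locales
  then have P: "matrix p *v x = p x" for x by (rule matrix_works)
  have pp: "p y = y" if "y \<in> V" for y using that by (intro uniq) (simp_all add: ortho_compl_def cinner_vec_def)
  have split: "cinner_vec (p x) y = cinner_vec (p x) (p y)" for x y
  proof -
    have "cinner_vec (p x) (y - p y) = 0" using p by (auto simp: ortho_compl_def)
    then show ?thesis using cinner_add_right[of "p x" "y - p y" "p y"] by simp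
  qed
  have "cinner_vec x (hermitian_conj (matrix p) *v y) = cinner_vec x (matrix p *v y)" for x y
  proof -
    have "cinner_vec x (p y) = cnj (cinner_vec (p y) x)" by (rule cinner_commute)
    also have "\<dots> = cinner_vec (p x) (p y)" using split[of y x] cinner_commute by metis
    finally show ?thesis using split[of x y] by (simp add: P flip: cinner_matrix_left)
  qed
  from this[of "axis i 1" "axis j 1" for i j] have "hermitian_conj (matrix p) = matrix p"
    by (simp add: cinner_axis vec_eq_iff)
  moreover have "matrix p ** matrix p = matrix p"
    by (simp add: matrix_eq P pp p flip: matrix_vector_mul_assoc)
  moreover have "range ((*v) (matrix p)) = V"
  proof
    show "range ((*v) (matrix p)) \<subseteq> V" using p by (auto simp: P)
    show "V \<subseteq> range ((*v) (matrix p))" using pp P by (metis rangeI subsetI)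
  qed
  ultimately show ?thesis unfolding orthogonal_projection_def by blast
qed

text \<open>A projection fixes its range, so PP' = P' and P'P = P; the adjoint of the first product
  is the second.\<close>

lemma orthogonal_projection_unique:
  assumes P: "orthogonal_projection P" and P': "orthogonal_projection P'"
    and "range ((*v) P) = range ((*v) P')"
  shows "P = P'"
proof -
  have absorb: "A ** B = B" if A: "orthogonal_projection A" and r: "range ((*v) A) = range ((*v) B)"
    for A B :: "'a cmat"
  proof -
    have "A *v (B *v x) = B *v x" for x
    proof -
      obtain y where y: "B *v x = A *v y" using r by (metis rangeE rangeI)
      have "A *v (A *v y) = A *v y"
        using A unfolding orthogonal_projection_def by (metis matrix_vector_mul_assoc)
      then show ?thesis by (simp only: y)
    qed
    then show ?thesis by (simp add: matrix_eq flip: matrix_vector_mul_assoc)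
  qed
  have "P ** P' = P'" "P' ** P = P" using assms by (auto intro!: absorb)
  moreover have "hermitian_conj (P ** P') = P' ** P"
    using P P' by (simp add: hermitian_conj_mult orthogonal_projection_def)
  ultimately show ?thesis using P' by (simp add: orthogonal_projection_def)
qed

lemma proj_onto:
  assumes "vec.subspace V"
  shows "orthogonal_projection (proj_onto V)" "range ((*v) (proj_onto V)) = V"
proof -
  have "\<exists>!P. orthogonal_projection P \<and> range ((*v) P) = V"
    using orthogonal_projection_exists[OF assms] orthogonal_projection_unique by metis
  from theI'[OF this] show "orthogonal_projection (proj_onto V)" "range ((*v) (proj_onto V)) = V"
    by (simp_all add: proj_onto_def)
qed

lemma orthogonal_projection_compl:
  "orthogonal_projection P \<Longrightarrow> orthogonal_projection (mat 1 - P)"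
  by (simp add: orthogonal_projection_def hermitian_conj_simps matrix_mult_diff_left
      matrix_mult_diff_right)

section \<open>Fixed points of trace-nonincreasing positive maps\<close>

lemma pos_semidef_sandwich_eq_0:
  assumes "pos_semidef X" "pos_semidef (- X)"
  shows "X = 0"
proof -
  have "trace (- X) = - trace X" by (simp add: trace_def sum_negf)
  then have "Re (trace X) = 0"
    using pos_semidef_trace_nonneg[OF assms(1)] pos_semidef_trace_nonneg[OF assms(2)] by simp
  with assms(1) show ?thesis by (rule pos_semidef_trace_eq_0)
qed

lemma compact_pos_semidef_trace_le:
  fixes S :: "('n::finite) cmat set"
  assumes "closed S" and psd: "\<And>Y. Y \<in> S \<Longrightarrow> pos_semidef Y" and tr: "\<And>Y. Y \<in> S \<Longrightarrow> Re (trace Y) \<le> b"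
  shows "compact S"
proof -
  obtain c where c: "c > 0" "\<And>A :: 'n cmat. pos_semidef A \<Longrightarrow> norm A \<le> c * Re (trace A)"
    using pos_semidef_norm_le_trace[where 'n = 'n] by metis
  have "norm Y \<le> c * b" if "Y \<in> S" for Y
    using order_trans[OF c(2)[OF psd[OF that]] mult_left_mono[OF tr[OF that] less_imp_le[OF c(1)]]] .
  then have "bounded S" by (rule boundedI)
  with assms(1) show ?thesis by (simp add: compact_eq_bounded_closed)
qed

lemma hermitian_fixed_point_eq_0:
  fixes \<Psi> :: "('n::finite) cmat \<Rightarrow> 'n cmat"
  assumes lin: "linear_cmap \<Psi>" and pos: "positive_map \<Psi>"
    and tr: "\<And>Y. pos_semidef Y \<Longrightarrow> Re (trace (\<Psi> Y)) \<le> Re (trace Y)"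
    and nofix: "\<And>Y. pos_semidef Y \<Longrightarrow> \<Psi> Y = Y \<Longrightarrow> Y = 0"
    and X: "hermitian_conj X = X" "\<Psi> X = X"
  shows "X = 0"
proof -
  have L: "linear \<Psi>" using lin by (rule linear_cmap_imp_linear)
  have neg: "pos_semidef (- X)" if X: "hermitian_conj X = X" "\<Psi> X = X" for X
  proof -
    obtain c where c: "c \<ge> 0" "pos_semidef (c *\<^sub>R mat 1 - X)"
      using pos_semidef_dominates[OF pos_semidef_mat_1 X(1)] by auto
    \<comment> \<open>The trace bound is chosen so that \<open>c *\<^sub>R mat 1\<close> belongs to
      C; together with positivity it makes C compact.\<close>
    define C where "C = {Y. pos_semidef Y} \<inter> {Y. pos_semidef (Y - X)} \<inter>
      {Y. Re (trace Y) \<le> Re (trace (c *\<^sub>R mat 1 :: 'n cmat))}"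
    have "closed {Y. pos_semidef (Y - X)}"
      using closed_vimage[OF closed_pos_semidef, of "\<lambda>Y. Y - X"]
      by (simp add: vimage_def continuous_intros)
    then have "closed C" unfolding C_def
      by (intro closed_Int closed_pos_semidef closed_Collect_le continuous_intros)
    then have "compact C"
      by (rule compact_pos_semidef_trace_le) (auto simp: C_def)
    moreover have "convex C"
    proof -
      have "convex {Y. pos_semidef (Y - X)}"
      proof -
        have "{Y. pos_semidef (Y - X)} = (\<lambda>Y. X + Y) ` {Y. pos_semidef Y}"
          by (auto simp: image_iff intro!: exI[of _ "_ - X"])
        then show ?thesis by (simp add: convex_translation convex_pos_semidef)
      qed
      moreover have "convex {Y :: 'n cmat. Re (trace Y) \<le> b}" for b
        by (auto simp: convex_def trace_add trace_scaleR intro: convex_bound_le)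
      ultimately show ?thesis unfolding C_def by (intro convex_Int convex_pos_semidef)
    qed
    moreover have "C \<noteq> {}"
    proof -
      have "c *\<^sub>R mat 1 \<in> C" using c by (simp add: C_def pos_semidef_scaleR pos_semidef_mat_1)
      then show ?thesis by blast
    qed
    moreover have "continuous_on C \<Psi>" using L by (rule linear_continuous_on_compose[OF continuous_on_id, simplified])
    moreover have "\<Psi> Y \<in> C" if Y: "Y \<in> C" for Y
    proof -
      \<comment> \<open>Since X is fixed, applying the map to Y - X shows that the lower bound X
        survives.\<close>
      have "pos_semidef (\<Psi> (Y - X))" using pos Y by (auto simp: positive_map_def C_def)
      then have "pos_semidef (\<Psi> Y - X)" by (simp add: linear_cmap_diff[OF lin] X)
      then show ?thesis using pos Y tr[of Y] by (auto simp: positive_map_def C_def)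
    qed
    then have "\<Psi> \<in> C \<rightarrow> C" by blast
    \<comment> \<open>The fixed point is positive semidefinite, hence 0, and 0 lying in C says
      exactly that -X is positive semidefinite.\<close>
    ultimately obtain Y where "Y \<in> C" "\<Psi> Y = Y" using brouwer by metis
    moreover from this have "Y = 0" using nofix by (simp add: C_def)
    ultimately show ?thesis by (simp add: C_def)
  qed
  have "\<Psi> (- X) = - X" using X by (simp add: linear_neg[OF L])
  then have "pos_semidef X" using neg[of "- X"] X by (simp add: hermitian_conj_simps)
  then show ?thesis using neg[OF X] pos_semidef_sandwich_eq_0 by blast
qed

lemma subspace_kernel: "vec.subspace {x. A *v x = 0}" for A :: "('n::finite) cmat"
  by (simp add: vec.subspace_def matrix_vector_right_distrib vector_scalar_commute)

lemma proj_onto_fixes: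
  assumes "vec.subspace V" "x \<in> V"
  shows "proj_onto V *v x = x"
proof -
  obtain y where "x = proj_onto V *v y" using proj_onto(2)[OF assms(1)] assms(2) by blast
  moreover have "proj_onto V ** proj_onto V = proj_onto V"
    using proj_onto(1)[OF assms(1)] by (simp add: orthogonal_projection_def)
  ultimately show ?thesis by (metis matrix_vector_mul_assoc)
qed

lemma proj_onto_in: "vec.subspace V \<Longrightarrow> proj_onto V *v x \<in> V"
  using proj_onto(2) by blast

lemma matrix_mult_eq_0_iff: "A ** B = 0 \<longleftrightarrow> (\<forall>x. A *v (B *v x) = 0)" for A B :: "('n::finite) cmat"
  by (simp add: matrix_eq matrix_vector_mul_assoc)

section \<open>Irreducible maps and the fundamental map\<close>

lemma compl_corner_eq:
  "R ** A = 0 \<Longrightarrow> A ** R = 0 \<Longrightarrow> (mat 1 - R) ** A ** (mat 1 - R) = A"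
  for A R :: "('n::finite) cmat"
  by (simp add: matrix_mult_diff_left matrix_mult_diff_right)

text \<open>P below is the support projection of Y. Positive semidefinite elements of its corner lie
  below multiples of Y, a relation that \<Phi> preserves because Y is fixed. So the corner is
  invariant, and irreducibility makes P = I unless Y = 0; but P annihilates
  \<open>x0\<close>.\<close>

lemma irreducible_fixed_point_kernel:
  fixes \<Phi> :: "('n::finite) cmat \<Rightarrow> 'n cmat"
  assumes lin: "linear_cmap \<Phi>" and pos: "positive_map \<Phi>" and irr: "irreducible_map \<Phi>"
    and Y: "pos_semidef Y" "\<Phi> Y = Y" and x0: "Y *v x0 = 0" "x0 \<noteq> 0"
  shows "Y = 0"
proof -
  define N where "N = {x. Y *v x = 0}"
  define R where "R = proj_onto N"
  define P where "P = mat 1 - R"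
  have N: "vec.subspace N" unfolding N_def by (rule subspace_kernel)
  have R: "orthogonal_projection R" unfolding R_def by (rule proj_onto(1)[OF N])
  have P: "orthogonal_projection P" unfolding P_def using R by (rule orthogonal_projection_compl)
  have hP: "hermitian_conj P = P" and hR: "hermitian_conj R = R"
    using P R by (simp_all add: orthogonal_projection_def)
  have PN: "P *v x = 0" if "x \<in> N" for x
    using proj_onto_fixes[OF N that] by (simp add: P_def R_def matrix_vector_mult_diff_rdistrib)
  have right: "\<Phi> (P ** X ** P) ** R = 0" for X
  proof (rule pos_semidef_spanning[where X = X])
    fix X :: "'n cmat" assume X: "pos_semidef X"
    have PXP: "pos_semidef (P ** X ** P)" using pos_semidef_congruence[OF X, of P] by (simp add: hP)
    have "(P ** X ** P) *v x = 0" if "Y *v x = 0" for x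
      using PN[of x] that by (simp add: N_def flip: matrix_vector_mul_assoc)
    from pos_semidef_dominates[OF Y(1) pos_semidef_hermitian[OF PXP] this]
    obtain c where c: "pos_semidef (c *\<^sub>R Y - P ** X ** P)" by blast
    have \<Phi>c: "pos_semidef (c *\<^sub>R Y - \<Phi> (P ** X ** P))"
    proof -
      have "\<Phi> (c *\<^sub>R Y - P ** X ** P) = c *\<^sub>R Y - \<Phi> (P ** X ** P)"
        by (simp add: linear_cmap_diff[OF lin] linear_cmap_scale[OF lin] Y scaleR_eq_scale_cmat)
      with c pos show ?thesis by (metis positive_map_def)
    qed
    have \<Phi>X: "pos_semidef (\<Phi> (P ** X ** P))" using PXP pos by (simp add: positive_map_def)
    have "\<Phi> (P ** X ** P) *v x = 0" if "x \<in> N" for x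
    proof (rule pos_semidef_kernel[OF \<Phi>X])
      \<comment> \<open>The image is squeezed between 0 and cY, whose form vanishes on N.\<close>
      show "x \<bullet> (\<Phi> (P ** X ** P) *v x) = 0"
        using pos_semidef_nonneg[OF \<Phi>c, of x] pos_semidef_nonneg[OF \<Phi>X, of x] that
        by (simp add: N_def matrix_vector_mult_diff_rdistrib scaleR_matrix_vector inner_diff_right)
    qed
    then show "\<Phi> (P ** X ** P) ** R = 0"
      by (simp add: matrix_mult_eq_0_iff R_def proj_onto_in[OF N])
  qed (simp_all add: matrix_mult_add_left matrix_add_ldistrib linear_cmap_add[OF lin]
      linear_cmap_scale[OF lin] scale_cmat_mult_left scale_cmat_mult_right scale_cmat_distribs)
  have left: "R ** \<Phi> (P ** X ** P) = 0" for X
  proof -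
    have "hermitian_conj (P ** hermitian_conj X ** P) = P ** X ** P"
      by (simp add: hermitian_conj_mult hermitian_conj_id hP matrix_mul_assoc)
    then have "R ** \<Phi> (P ** X ** P) = hermitian_conj (\<Phi> (P ** hermitian_conj X ** P) ** R)"
      by (simp add: hermitian_conj_mult hR flip: positive_map_hermitian_conj[OF lin pos])
    then show ?thesis by (simp add: right hermitian_conj_zero)
  qed
  have "\<Phi> (P ** X ** P) = P ** \<Phi> (P ** X ** P) ** P" for X
    using compl_corner_eq[OF left[of X] right[of X], folded P_def] by simp
  then have "\<Phi> ` range (\<lambda>X. P ** X ** P) \<subseteq> range (\<lambda>X. P ** X ** P)" by blast
  with irr P have "P = 0 \<or> P = mat 1" unfolding irreducible_map_def by blast
  moreover have "P \<noteq> mat 1" using PN[of x0] x0 by (auto simp: N_def)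
  ultimately have "R = mat 1" by (simp add: P_def)
  moreover have "Y ** R = 0"
    using proj_onto_in[OF N] by (simp add: matrix_mult_eq_0_iff R_def N_def)
  ultimately show ?thesis by simp
qed

locale irreducible_channel =
  fixes \<Phi> :: "('n::finite) cmat \<Rightarrow> 'n cmat"
  assumes lin: "linear_cmap \<Phi>" and pos: "positive_map \<Phi>"
    and tp: "trace_preserving \<Phi>" and irr: "irreducible_map \<Phi>"
begin

lemma trace_\<Phi>: "trace (\<Phi> X) = trace X"
  using tp by (simp add: trace_preserving_def)

lemma pos_\<Phi>: "pos_semidef X \<Longrightarrow> pos_semidef (\<Phi> X)"
  using pos by (simp add: positive_map_def)

lemma invariant_state_exists: "\<exists>\<pi>. density_matrix \<pi> \<and> \<Phi> \<pi> = \<pi>"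
proof -
  let ?S = "{A :: 'n cmat. pos_semidef A} \<inter> {A. trace A = 1}"
  have "closed ?S"
    by (intro closed_Int closed_pos_semidef closed_Collect_eq continuous_intros)
  then have "compact ?S"
    by (rule compact_pos_semidef_trace_le[where b = 1]) auto
  moreover have "convex {A :: 'n cmat. trace A = 1}"
    by (auto simp: convex_def trace_add trace_scaleR simp flip: of_real_add)
  then have "convex ?S" by (intro convex_Int convex_pos_semidef)
  moreover have "(1 / real CARD('n)) *\<^sub>R mat 1 \<in> ?S"
    by (simp add: pos_semidef_scaleR pos_semidef_mat_1 trace_scaleR trace_I)
  then have "?S \<noteq> {}" by blast
  moreover have "continuous_on ?S \<Phi>"
    using linear_cmap_imp_linear[OF lin] by (intro linear_continuous_on linear_conv_bounded_linear[THEN iffD1])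
  moreover have "\<Phi> \<in> ?S \<rightarrow> ?S" using pos_\<Phi> trace_\<Phi> by auto
  ultimately obtain \<pi> where "\<pi> \<in> ?S" "\<Phi> \<pi> = \<pi>" using brouwer by metis
  then show ?thesis by (auto simp: density_matrix_def)
qed

text \<open>A kernel vector would force the state to be 0, against trace 1. Thus invariant states
  are strictly positive.\<close>

lemma density_fixed_point_kernel:
  assumes "density_matrix \<pi>" "\<Phi> \<pi> = \<pi>" "\<pi> *v x = 0"
  shows "x = 0"
proof (rule ccontr)
  assume "x \<noteq> 0"
  with assms have "\<pi> = 0"
    using irreducible_fixed_point_kernel[OF lin pos irr] by (auto simp: density_matrix_def)
  with assms(1) show False by (simp add: density_matrix_def trace_def)
qed

text \<open>Subtracting from \<open>X\<close> the largest multiple of the invariant state that keeps it positive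
  semidefinite leaves a positive semidefinite fixed point with a kernel, which must vanish.\<close>

lemma hermitian_traceless_fixed_point:
  assumes X: "hermitian_conj X = X" "\<Phi> X = X" "trace X = 0"
  shows "X = 0"
proof -
  obtain \<pi> where \<pi>: "density_matrix \<pi>" "\<Phi> \<pi> = \<pi>" using invariant_state_exists by blast
  have psd: "pos_semidef \<pi>" using \<pi> by (simp add: density_matrix_def)
  have \<pi>_pos: "x \<bullet> (\<pi> *v x) > 0" if "x \<noteq> 0" for x
    using pos_semidef_nonneg[OF psd, of x] pos_semidef_kernel[OF psd, of x]
      density_fixed_point_kernel[OF \<pi>, of x] that by (auto simp: less_le)
  \<comment> \<open>The minimum of this quotient over the sphere is the largest admissible multiple;
    strict positivity of the state keeps the denominator nonzero.\<close>
  let ?f = "\<lambda>x. (x \<bullet> (X *v x)) / (x \<bullet> (\<pi> *v x))"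
  have "\<forall>x\<in>sphere 0 1. x \<bullet> (\<pi> *v x) \<noteq> 0"
  proof
    fix x :: "complex ^ 'n" assume "x \<in> sphere 0 1"
    then have "x \<noteq> 0" by auto
    then show "x \<bullet> (\<pi> *v x) \<noteq> 0" using \<pi>_pos by (metis less_irrefl)
  qed
  then have "continuous_on (sphere 0 1) ?f" by (intro continuous_intros)
  moreover have "axis undefined 1 \<in> sphere (0 :: complex ^ 'n) 1" by simp
  then have "sphere (0 :: complex ^ 'n) 1 \<noteq> {}" by blast
  ultimately have "\<exists>u\<in>sphere 0 1. \<forall>y\<in>sphere 0 1. ?f u \<le> ?f y"
    by (intro continuous_attains_inf compact_sphere)
  then obtain u where u: "u \<in> sphere 0 1" and min: "\<And>y. y \<in> sphere 0 1 \<Longrightarrow> ?f u \<le> ?f y"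
    by blast
  have u0: "u \<noteq> 0" using u by auto
  define m where "m = ?f u"
  define Y where "Y = X - m *\<^sub>R \<pi>"
  have Y: "x \<bullet> (Y *v x) = x \<bullet> (X *v x) - m * (x \<bullet> (\<pi> *v x))" for x
    by (simp add: Y_def matrix_vector_mult_diff_rdistrib scaleR_matrix_vector inner_diff_right)
  have "0 \<le> x \<bullet> (Y *v x)" for x
  proof (cases "x = 0")
    case False
    let ?y = "(1 / norm x) *\<^sub>R x"
    have "m \<le> ?f ?y" unfolding m_def using False by (intro min) simp
    moreover have "?y \<bullet> (A *v ?y) = (x \<bullet> (A *v x)) / (norm x)\<^sup>2" for A
      unfolding matrix_vector_scaleR inner_scaleR_left inner_scaleR_right
      by (simp add: power2_eq_square)
    ultimately have "m \<le> ?f x" using False by (simp only:) simp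
    then show ?thesis using \<pi>_pos[OF False] by (simp add: Y pos_le_divide_eq)
  qed simp
  then have psd_Y: "pos_semidef Y"
    by (simp add: pos_semidef_iff Y_def hermitian_conj_simps X pos_semidef_hermitian[OF psd])
  have "u \<bullet> (Y *v u) = 0" using \<pi>_pos[OF u0] by (simp add: Y m_def)
  then have "Y *v u = 0" by (rule pos_semidef_kernel[OF psd_Y])
  moreover have "\<Phi> Y = Y"
    by (simp add: Y_def linear_cmap_diff[OF lin] scaleR_eq_scale_cmat linear_cmap_scale[OF lin] X \<pi>)
  ultimately have "Y = 0" using irreducible_fixed_point_kernel[OF lin pos irr psd_Y] u0 by blast
  then have X_eq: "X = m *\<^sub>R \<pi>" by (simp add: Y_def)
  with X(3) \<pi> have "m = 0" by (simp add: trace_scaleR density_matrix_def)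
  with X_eq show ?thesis by simp
qed

definition "\<pi> = invariant_state \<Phi>"

text \<open>Two invariant states differ by a traceless Hermitian fixed point, which is 0; this
  justifies the definite description in \<open>invariant_state\<close>.\<close>

lemma density_\<pi>: "density_matrix \<pi>" and \<Phi>_\<pi>: "\<Phi> \<pi> = \<pi>"
proof -
  have "\<exists>!\<pi>. density_matrix \<pi> \<and> \<Phi> \<pi> = \<pi>"
  proof (rule ex_ex1I[OF invariant_state_exists])
    fix \<rho> \<sigma> assume "density_matrix \<rho> \<and> \<Phi> \<rho> = \<rho>" "density_matrix \<sigma> \<and> \<Phi> \<sigma> = \<sigma>"
    then have "\<rho> - \<sigma> = 0"
      by (intro hermitian_traceless_fixed_point)
        (auto simp: density_matrix_def hermitian_conj_simps pos_semidef_hermitian trace_sub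
          linear_cmap_diff[OF lin])
    then show "\<rho> = \<sigma>" by simp
  qed
  from theI'[OF this] show "density_matrix \<pi>" "\<Phi> \<pi> = \<pi>"
    by (simp_all add: \<pi>_def invariant_state_def)
qed

lemma trace_\<pi>: "trace \<pi> = 1" and hermitian_\<pi>: "hermitian_conj \<pi> = \<pi>"
  using density_\<pi> by (simp_all add: density_matrix_def pos_semidef_hermitian)

text \<open>The map preserves the trace, so a kernel element H is traceless; then its \<Omega> term
  disappears and H is a fixed point of \<Phi>.\<close>

lemma bij_fundamental: "bij (\<lambda>X. X - \<Phi> X + Omega_map \<Phi> X)"
proof (rule bij_cmapI)
  show "linear_cmap (\<lambda>X. X - \<Phi> X + Omega_map \<Phi> X)"
    by (simp add: linear_cmap_iff Omega_map_def linear_cmap_add[OF lin] linear_cmap_scale[OF lin]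
        trace_add trace_scale_cmat) (simp add: scale_cmat_def vec_eq_iff algebra_simps)
  show "hermitian_conj X - \<Phi> (hermitian_conj X) + Omega_map \<Phi> (hermitian_conj X)
      = hermitian_conj (X - \<Phi> X + Omega_map \<Phi> X)" for X
    by (simp add: hermitian_conj_simps positive_map_hermitian_conj[OF lin pos] Omega_map_def
        trace_hermitian_conj hermitian_\<pi>[unfolded \<pi>_def])
  fix H assume H: "hermitian_conj H = H" "H - \<Phi> H + Omega_map \<Phi> H = 0"
  have "trace (H - \<Phi> H + Omega_map \<Phi> H) = trace H"
    by (simp add: trace_add trace_sub trace_\<Phi> Omega_map_def trace_scale_cmat trace_\<pi>[unfolded \<pi>_def])
  with H have tr: "trace H = 0" by (simp add: trace_def)
  with H show "H = 0"
    by (intro hermitian_traceless_fixed_point) (simp_all add: Omega_map_def scale_cmat_distribs)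
qed

text \<open>Taking traces in the equation defining the inverse cancels I - \<Phi>, so Z preserves
  the trace and the \<Omega> term can be written with Tr X.\<close>

lemma fundamental_map_eq:
  "fundamental_map \<Phi> X - \<Phi> (fundamental_map \<Phi> X) = X - scale_cmat (trace X) \<pi>"
  and trace_fundamental_map: "trace (fundamental_map \<Phi> X) = trace X"
proof -
  let ?Y = "fundamental_map \<Phi> X"
  have eq: "?Y - \<Phi> ?Y + scale_cmat (trace ?Y) \<pi> = X"
    using surj_f_inv_f[OF bij_is_surj[OF bij_fundamental], of X]
    by (simp add: fundamental_map_def Omega_map_def \<pi>_def)
  have "trace (?Y - \<Phi> ?Y + scale_cmat (trace ?Y) \<pi>) = trace ?Y"
    by (simp add: trace_add trace_sub trace_\<Phi> trace_scale_cmat trace_\<pi>)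
  with eq show tr: "trace ?Y = trace X" by simp
  show "?Y - \<Phi> ?Y = X - scale_cmat (trace X) \<pi>" using eq unfolding tr by (simp add: algebra_simps)
qed

end

section \<open>Hitting times\<close>

lemma trace_congruence_projection:
  fixes X :: "('n::finite) cmat"
  assumes "P ** P = P"
  shows "trace (P ** X ** P) = trace (P ** X)"
proof -
  have "trace (P ** X ** P) = trace (P ** (P ** X))" by (rule trace_mul_sym)
  then show ?thesis by (simp add: matrix_mul_assoc assms)
qed

text \<open>The block of the sum from n div 2 to n - 1 has at least n/2 terms, each at least u(n),
  and it tends to 0. This disposes of the boundary term when the mean hitting time is summed by
  parts.\<close>

lemma decseq_summable_imp_mult_tendsto_0:
  fixes u :: "nat \<Rightarrow> real"
  assumes dec: "decseq u" and nonneg: "\<And>n. 0 \<le> u n" and "summable u"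
  shows "(\<lambda>n. real n * u n) \<longlonglongrightarrow> 0"
proof -
  let ?s = "\<lambda>n. \<Sum>k<n. u k"
  have s: "?s \<longlonglongrightarrow> suminf u" using assms(3) by (rule summable_LIMSEQ)
  have "filterlim (\<lambda>n::nat. n div 2) sequentially sequentially"
    by (rule filterlim_at_top_div_const_nat) simp
  then have "(\<lambda>n. ?s (n div 2)) \<longlonglongrightarrow> suminf u" by (rule filterlim_compose[OF s])
  then have lim: "(\<lambda>n. 2 * (?s n - ?s (n div 2))) \<longlonglongrightarrow> 0"
    using tendsto_mult_right_zero[OF LIM_zero[OF tendsto_diff[OF s]]] s
    by (auto intro!: tendsto_eq_intros)
  have bound: "real n * u n \<le> 2 * (?s n - ?s (n div 2))" for n
  proof -
    have "?s n - ?s (n div 2) = sum u {n div 2..<n}"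
      by (simp add: sum_diff_nat_ivl lessThan_atLeast0)
    moreover have "real (card {n div 2..<n}) * u n \<le> sum u {n div 2..<n}"
      by (rule sum_bounded_below) (use dec in \<open>auto simp: decseq_def\<close>)
    moreover have "(real n / 2) * u n \<le> real (card {n div 2..<n}) * u n"
      using nonneg by (intro mult_right_mono) (auto simp: field_simps)
    ultimately show ?thesis by simp
  qed
  show ?thesis
    by (rule tendsto_sandwich[OF _ _ tendsto_const lim]) (use bound nonneg in auto)
qed

locale hitting_channel = irreducible_channel \<Phi> for \<Phi> :: "('n::finite) cmat \<Rightarrow> 'n cmat" +
  fixes V :: "(complex ^ 'n) set"
  assumes V: "vec.subspace V" "V \<noteq> {0}"
begin

abbreviation "R \<equiv> proj_onto V"

text \<open>One step followed by the outcome that V was missed; the trace of its r-th power at a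
  state is the probability of surviving r steps.\<close>

definition "T X = Q_map V (\<Phi> X)"

definition "G = inv (\<lambda>X. X - T X)"

lemma R: "orthogonal_projection R" by (rule proj_onto(1)[OF V(1)])

lemma R_simps: "R ** R = R" "hermitian_conj R = R"
  "(mat 1 - R) ** (mat 1 - R) = mat 1 - R" "hermitian_conj (mat 1 - R) = mat 1 - R"
  using R orthogonal_projection_compl[OF R] by (simp_all add: orthogonal_projection_def)

lemma pos_Q_map: "pos_semidef X \<Longrightarrow> pos_semidef (Q_map V X)"
  using pos_semidef_congruence[of X "mat 1 - R"] by (simp add: Q_map_def R_simps)

lemma pos_P_map: "pos_semidef X \<Longrightarrow> pos_semidef (P_map V X)"
  using pos_semidef_congruence[of X R] by (simp add: P_map_def R_simps)

lemma hermitian_Q_map: "Q_map V (hermitian_conj X) = hermitian_conj (Q_map V X)"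
  by (simp add: Q_map_def hermitian_conj_mult R_simps matrix_mul_assoc)

lemma linear_Q_map: "linear_cmap (Q_map V)"
  by (simp add: linear_cmap_iff Q_map_def matrix_mult_add_left matrix_add_ldistrib
      scale_cmat_mult_left scale_cmat_mult_right)

lemma Q_map_idem: "Q_map V (Q_map V X) = Q_map V X"
  unfolding Q_map_def by (metis R_simps(3) matrix_mul_assoc)

lemma trace_P_map: "trace (P_map V X) = trace X - trace (Q_map V X)"
  unfolding P_map_def Q_map_def
  by (simp add: trace_congruence_projection R_simps) (simp add: matrix_mult_diff_left trace_sub)

lemma linear_T: "linear_cmap T"
  using linear_Q_map lin by (simp add: linear_cmap_iff T_def)

lemma pos_T: "pos_semidef X \<Longrightarrow> pos_semidef (T X)"
  by (simp add: T_def pos_Q_map pos_\<Phi>)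

lemma trace_T: "trace (T X) = trace X - trace (P_map V (\<Phi> X))"
  by (simp add: T_def trace_P_map trace_\<Phi>)

text \<open>No trace is lost in the step, so \<Phi> Y has no weight on V and lies in the Q corner
  already. Hence Y is a fixed point of \<Phi> itself with V in its kernel.\<close>

lemma T_no_fixed_points:
  assumes Y: "pos_semidef Y" "T Y = Y"
  shows "Y = 0"
proof -
  let ?W = "\<Phi> Y"
  have W: "pos_semidef ?W" using Y(1) by (rule pos_\<Phi>)
  have "trace (P_map V ?W) = 0" using trace_T[of Y] Y(2) by simp
  then have "P_map V ?W = 0" using pos_semidef_trace_eq_0[OF pos_P_map[OF W]] by simp
  then have "(R *v x) \<bullet> (?W *v (R *v x)) = 0" for x
    by (simp add: inner_matrix_left R_simps P_map_def matrix_vector_mul_assoc matrix_mul_assoc)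
  then have WR: "?W ** R = 0"
    using pos_semidef_kernel[OF W] by (simp add: matrix_mult_eq_0_iff)
  moreover from this have "R ** ?W = 0"
    using hermitian_conj_mult[of ?W R] by (simp add: R_simps pos_semidef_hermitian[OF W] hermitian_conj_zero)
  ultimately have "Y = ?W" using Y(2) compl_corner_eq[of R ?W] by (simp add: T_def Q_map_def)
  obtain v where v: "v \<in> V" "v \<noteq> 0" using V by (auto simp: vec.subspace_def)
  have "Y *v v = (?W ** R) *v v"
    using \<open>Y = ?W\<close> proj_onto_fixes[OF V(1) v(1)] by (simp flip: matrix_vector_mul_assoc)
  then have "Y *v v = 0" by (simp add: WR)
  with v \<open>Y = ?W\<close> show ?thesis using irreducible_fixed_point_kernel[OF lin pos irr Y(1)] by metis
qed

lemma bij_I_minus_T: "bij (\<lambda>X. X - T X)"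
proof (rule bij_cmapI)
  show "linear_cmap (\<lambda>X. X - T X)"
    by (simp add: linear_cmap_iff linear_cmap_add[OF linear_T] linear_cmap_scale[OF linear_T]
        scale_cmat_distribs)
  show "hermitian_conj X - T (hermitian_conj X) = hermitian_conj (X - T X)" for X
    by (simp add: T_def hermitian_conj_simps hermitian_Q_map positive_map_hermitian_conj[OF lin pos])
  show "H = 0" if "hermitian_conj H = H" "H - T H = 0" for H
  proof (rule hermitian_fixed_point_eq_0[OF linear_T])
    show "positive_map T" by (simp add: positive_map_def pos_T)
    show "Re (trace (T Y)) \<le> Re (trace Y)" if "pos_semidef Y" for Y
      using pos_semidef_trace_nonneg[OF pos_P_map[OF pos_\<Phi>[OF that]]] by (simp add: trace_T)
  qed (use that T_no_fixed_points in auto)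
qed

lemma G_eq: "G X - T (G X) = X"
  using surj_f_inv_f[OF bij_is_surj[OF bij_I_minus_T], of X] by (simp add: G_def)

lemma G_eqI: "Y - T Y = X \<Longrightarrow> G X = Y"
  using inv_f_f[OF bij_is_inj[OF bij_I_minus_T], of Y] by (simp add: G_def)

lemma linear_G: "linear_cmap G"
proof (unfold linear_cmap_iff, intro conjI allI)
  show "G (X + Y) = G X + G Y" for X Y
  proof (rule G_eqI)
    have "G X + G Y - T (G X + G Y) = (G X - T (G X)) + (G Y - T (G Y))"
      by (simp add: linear_cmap_add[OF linear_T])
    then show "G X + G Y - T (G X + G Y) = X + Y" by (simp only: G_eq)
  qed
  show "G (scale_cmat c X) = scale_cmat c (G X)" for c X
    by (intro G_eqI) (simp add: linear_cmap_scale[OF linear_T] G_eq flip: scale_cmat_distribs)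
qed

lemma G_T: "G (T X) = G X - X"
  using G_eq[of X] by (intro G_eqI) (simp add: linear_cmap_diff[OF linear_T] algebra_simps)

lemma trace_compl_Q_map: "trace (compl_Q_map V X) = trace X - trace (Q_map V X)"
  by (simp add: compl_Q_map_def trace_sub)

text \<open>Under the trace, I - Q after \<Phi> acts like I - T, which cancels one of the two
  factors G in K. The off-diagonal corners kept by I - Q are traceless, so this is also the trace of
  PK.\<close>

lemma trace_compl_hitting_time_map:
  "trace (compl_Q_map V (hitting_time_map \<Phi> V X)) = trace (G X)"
proof -
  have "hitting_time_map \<Phi> V X = \<Phi> (G (G X))"
    by (simp add: hitting_time_map_def G_def T_def numeral_2_eq_2)
  then have "trace (compl_Q_map V (hitting_time_map \<Phi> V X)) = trace (G (G X)) - trace (T (G (G X)))"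
    by (simp add: trace_compl_Q_map T_def trace_\<Phi>)
  also have "\<dots> = trace (G X)" using G_eq[of "G X"] by (metis trace_sub)
  finally show ?thesis .
qed

lemma trace_G_identity:
  "trace (G (Q_map V X)) - trace X * trace (G (Q_map V \<pi>))
     = trace X - trace (G (compl_Q_map V (fundamental_map \<Phi> X)))"
proof -
  let ?Z = "fundamental_map \<Phi> X"
  \<comment> \<open>Evaluates the same quantity twice: here Q\<Phi>Z becomes TZ, which GT = G - I
    absorbs, and at the end Z - \<Phi>Z is replaced by X - Tr(X) \<pi>.\<close>
  have "trace (G (Q_map V (?Z - \<Phi> ?Z))) = trace (G (Q_map V ?Z)) - trace (G (T ?Z))"
    by (simp add: T_def linear_cmap_diff[OF linear_Q_map] linear_cmap_diff[OF linear_G] trace_sub)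
  also have "\<dots> = trace ?Z - trace (G (compl_Q_map V ?Z))"
    by (simp add: G_T compl_Q_map_def linear_cmap_diff[OF linear_G] trace_sub)
  finally show ?thesis
    by (simp add: fundamental_map_eq trace_fundamental_map linear_cmap_diff[OF linear_Q_map]
        linear_cmap_diff[OF linear_G] linear_cmap_scale[OF linear_Q_map]
        linear_cmap_scale[OF linear_G] trace_sub trace_scale_cmat)
qed

text \<open>First-visit probabilities are the decrements of the survival probabilities u, so
  summation by parts turns the mean into the sum of u, which is Tr(G \<rho>). Convergence is drawn
  from positivity rather than from a spectral radius bound.\<close>

lemma mean_hitting_time_eq:
  assumes \<rho>: "density_matrix \<rho>"
  shows "mean_hitting_time \<Phi> V \<rho> = ereal (Re (trace (G \<rho>)))"
proof -
  define t where "t r = (T ^^ r) \<rho>" for r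
  define u where "u r = Re (trace (t r))" for r
  have t_Suc: "t (Suc r) = T (t r)" for r by (simp add: t_def)
  have psd: "pos_semidef (t r)" for r
    by (induction r) (use \<rho> in \<open>simp_all add: t_def density_matrix_def pos_T\<close>)
  have u_nonneg: "0 \<le> u r" for r unfolding u_def using psd by (rule pos_semidef_trace_nonneg)
  have prob: "first_visit_prob \<Phi> V (Suc r) \<rho> = u r - u (Suc r)" for r
  proof -
    have "(Q_map V \<circ> \<Phi>) = T" by (auto simp: T_def)
    then have "first_visit_prob \<Phi> V (Suc r) \<rho> = Re (trace (P_map V (\<Phi> (t r))))"
      by (simp add: first_visit_prob_def t_def)
    then show ?thesis by (simp add: u_def t_Suc trace_T)
  qed
  have prob_nonneg: "u (Suc r) \<le> u r" for r
    using pos_semidef_trace_nonneg[OF pos_P_map[OF pos_\<Phi>[OF psd[of r]]]]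
    by (simp add: u_def t_Suc trace_T)
  then have dec: "decseq u" by (rule decseq_SucI)
  have u0: "u 0 = 1" using \<rho> by (simp add: u_def t_def density_matrix_def)
  have lin_tG: "linear (\<lambda>X. Re (trace (G X)))"
    by (auto simp: linear_cmap_add[OF linear_G] linear_cmap_scale[OF linear_G] scaleR_eq_scale_cmat
        trace_add trace_scale_cmat intro!: linearI)
  then have blin: "bounded_linear (\<lambda>X. Re (trace (G X)))"
    by (simp add: linear_conv_bounded_linear)
  \<comment> \<open>Telescopes because X = G X - G (T X).\<close>
  have partial: "(\<Sum>r<N. u r) = Re (trace (G \<rho>)) - Re (trace (G (t N)))" for N
  proof (induction N)
    case (Suc N)
    then show ?case using G_T[of "t N"] by (simp add: t_Suc u_def trace_sub)
  qed (simp add: t_def)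
  obtain c where c: "c > 0" "\<And>A :: 'n cmat. pos_semidef A \<Longrightarrow> norm A \<le> c * Re (trace A)"
    using pos_semidef_norm_le_trace[where 'n = 'n] by metis
  have norm_t: "norm (t r) \<le> c * u r" for r unfolding u_def using psd by (rule c(2))
  obtain b where b: "b > 0" "\<And>X. norm (Re (trace (G X))) \<le> norm X * b"
    using bounded_linear.pos_bounded[OF blin] by blast
  \<comment> \<open>The remainder Tr(G t(N)) is bounded: u decreases from 1 and dominates the norm
    of t up to the factor c.\<close>
  have "summable u"
  proof (rule bounded_imp_summable[OF u_nonneg])
    fix N
    have "norm (t (Suc N)) \<le> c * 1"
      using norm_t[of "Suc N"] decseqD[OF dec, of 0 "Suc N"] u0 c(1)
      by (metis le0 less_imp_le mult_left_mono order_trans)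
    then have "norm (Re (trace (G (t (Suc N))))) \<le> c * b"
      using b by (metis mult.right_neutral mult_right_mono less_imp_le order_trans)
    then show "(\<Sum>r\<le>N. u r) \<le> Re (trace (G \<rho>)) + c * b"
      using partial[of "Suc N"] by (simp add: lessThan_Suc_atMost abs_le_iff)
  qed
  then have u_lim: "u \<longlonglongrightarrow> 0" by (rule summable_LIMSEQ_zero)
  have "t \<longlonglongrightarrow> 0"
  proof (rule Lim_null_comparison)
    show "\<forall>\<^sub>F r in sequentially. norm (t r) \<le> c * u r" using norm_t by simp
    show "(\<lambda>r. c * u r) \<longlonglongrightarrow> 0" using u_lim by (rule tendsto_mult_right_zero)
  qed
  then have "(\<lambda>N. Re (trace (G (t N)))) \<longlonglongrightarrow> 0"
    by (rule bounded_linear.tendsto_zero[OF blin])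
  then have "(\<lambda>N. \<Sum>r<N. u r) \<longlonglongrightarrow> Re (trace (G \<rho>)) - 0"
    unfolding partial by (intro tendsto_diff tendsto_const)
  moreover have by_parts: "(\<Sum>r<N. real (Suc r) * (u r - u (Suc r))) = (\<Sum>r<N. u r) - real N * u N" for N
    by (induction N) (simp_all add: algebra_simps)
  ultimately have "(\<lambda>r. real (Suc r) * (u r - u (Suc r))) sums Re (trace (G \<rho>))"
    using tendsto_diff[OF _ decseq_summable_imp_mult_tendsto_0[OF dec u_nonneg \<open>summable u\<close>]]
    unfolding sums_def by_parts by fastforce
  \<comment> \<open>The hitting probability is therefore 1, which selects the finite branch of
    \<open>mean_hitting_time\<close>.\<close>
  moreover have "(\<lambda>r. u r - u (Suc r)) sums (u 0 - 0)" using u_lim by (rule telescope_sums')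
  ultimately show ?thesis
    unfolding mean_hitting_time_def hitting_prob_def prob u0
    by (simp add: sums_ereal[THEN iffD2, THEN sums_unique, symmetric] one_ereal_def)
qed

text \<open>G commutes with the adjoint by uniqueness of its value. The hitting time only sees a
  real part, whereas the theorem equates it with a complex trace.\<close>

lemma trace_G_real:
  assumes "hermitian_conj X = X"
  shows "trace (G X) = complex_of_real (Re (trace (G X)))"
proof -
  have "G X = hermitian_conj (G X)"
  proof (rule G_eqI)
    have "hermitian_conj (G X - T (G X)) = X" by (simp add: G_eq assms)
    then show "hermitian_conj (G X) - T (hermitian_conj (G X)) = X"
      by (simp add: T_def hermitian_conj_simps hermitian_Q_map positive_map_hermitian_conj[OF lin pos])
  qed
  then have "trace (G X) = cnj (trace (G X))" by (metis trace_hermitian_conj)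
  then show ?thesis by (simp add: complex_eq_iff)
qed

lemma compl_Q_map_simps:
  "compl_Q_map V (compl_Q_map V X) = compl_Q_map V X"
  "compl_Q_map V (Q_map V X) = 0"
  "compl_Q_map V (X + Y) = compl_Q_map V X + compl_Q_map V Y"
  "compl_Q_map V (X - Y) = compl_Q_map V X - compl_Q_map V Y"
  by (simp_all add: compl_Q_map_def Q_map_idem linear_cmap_diff[OF linear_Q_map]
      linear_cmap_add[OF linear_Q_map])

text \<open>I - Q kills the second diagonal block. Using D instead of K drops the contribution of
  the off-diagonal block K12, so that G meets only the (I - Q) part of its argument.\<close>

lemma trace_compl_block_diag:
  "trace (compl_Q_map V (block_diag V (hitting_time_map \<Phi> V) X)) = trace (G (compl_Q_map V X))"
  by (simp add: block_diag_def block11_def block22_def compl_Q_map_simps trace_compl_hitting_time_map)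

end

section \<open>Pure states on V and on its orthogonal complement\<close>

lemma pure_state_mult: "A ** pure_state \<phi> = (\<chi> i j. (A *v \<phi>) $ i * cnj (\<phi> $ j))"
  by (simp add: matrix_matrix_mult_def matrix_vector_mult_def pure_state_def vec_eq_iff
      sum_distrib_right mult.assoc)

lemma pure_state_density:
  assumes "norm \<phi> = 1"
  shows "density_matrix (pure_state \<phi>)"
proof -
  have herm: "hermitian_conj (pure_state \<phi>) = pure_state \<phi>"
    by (simp add: hermitian_conj_def pure_state_def vec_eq_iff mult.commute)
  have "x \<bullet> (pure_state \<phi> *v x) = (cmod (cinner_vec \<phi> x))\<^sup>2" for x
  proof -
    have "pure_state \<phi> *v x = cinner_vec \<phi> x *s \<phi>"
      by (simp add: pure_state_def cinner_vec_def matrix_vector_mult_def vec_eq_iff sum_distrib_left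
          algebra_simps)
    then have "cinner_vec x (pure_state \<phi> *v x) = cinner_vec \<phi> x * cnj (cinner_vec \<phi> x)"
      by (simp add: cinner_scale_right flip: cinner_commute)
    then show ?thesis by (simp add: inner_eq_Re_cinner complex_norm_square[symmetric] del: of_real_power)
  qed
  then have "pos_semidef (pure_state \<phi>)" using herm by (simp add: pos_semidef_iff)
  moreover have "trace (pure_state \<phi>) = cinner_vec \<phi> \<phi>"
    by (simp add: trace_def pure_state_def cinner_vec_def mult.commute)
  ultimately show ?thesis using assms by (simp add: density_matrix_def cinner_self)
qed

lemma proj_onto_ortho_compl:
  assumes V: "vec.subspace V" and "\<phi> \<in> ortho_compl V"
  shows "proj_onto V *v \<phi> = 0"
proof -
  let ?R = "proj_onto V"
  have "cinner_vec (?R *v (?R *v \<phi>)) \<phi> = 0"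
    using assms proj_onto_in[OF V] by (simp add: ortho_compl_def)
  then have "cinner_vec (?R *v \<phi>) (?R *v \<phi>) = 0"
    using proj_onto(1)[OF V] by (simp add: cinner_matrix_left orthogonal_projection_def)
  then show ?thesis by (simp add: cinner_self)
qed

lemma Q_map_pure_state:
  assumes V: "vec.subspace V"
  shows "\<psi> \<in> V \<Longrightarrow> Q_map V (pure_state \<psi>) = 0"
    and "\<phi> \<in> ortho_compl V \<Longrightarrow> Q_map V (pure_state \<phi>) = pure_state \<phi>"
proof -
  let ?R = "proj_onto V"
  show "Q_map V (pure_state \<psi>) = 0" if "\<psi> \<in> V"
  proof -
    have "(mat 1 - ?R) ** pure_state \<psi> = 0"
      using proj_onto_fixes[OF V that]
      by (simp add: pure_state_mult matrix_vector_mult_diff_rdistrib vec_eq_iff)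
    then show ?thesis by (simp add: Q_map_def)
  qed
  show "Q_map V (pure_state \<phi>) = pure_state \<phi>" if "\<phi> \<in> ortho_compl V"
  proof -
    have 0: "?R ** pure_state \<phi> = 0"
      using proj_onto_ortho_compl[OF V that] by (simp add: pure_state_mult vec_eq_iff)
    have "hermitian_conj (pure_state \<phi>) = pure_state \<phi>"
      by (simp add: hermitian_conj_def pure_state_def vec_eq_iff mult.commute)
    then have "pure_state \<phi> ** ?R = hermitian_conj (?R ** pure_state \<phi>)"
      using proj_onto(1)[OF V] by (simp add: hermitian_conj_mult orthogonal_projection_def)
    then have "pure_state \<phi> ** ?R = 0" by (simp add: 0 hermitian_conj_zero)
    with 0 show ?thesis unfolding Q_map_def by (rule compl_corner_eq)
  qed
qed

theorem theorem4p3: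
  fixes \<Phi> :: "complex ^ 'n ^ 'n \<Rightarrow> complex ^ 'n ^ 'n"
    and V :: "(complex ^ 'n) set"
    and Z K D :: "complex ^ 'n ^ 'n \<Rightarrow> complex ^ 'n ^ 'n"
  assumes "linear_cmap \<Phi>" and "positive_map \<Phi>" and "trace_preserving \<Phi>" and "irreducible_map \<Phi>"
    and "vec.subspace V" and "V \<noteq> {0}" and "V \<noteq> UNIV"
    and "Z = fundamental_map \<Phi>"
    and "K = hitting_time_map \<Phi> V"
    and "D = block_diag V K"
  shows "(\<forall>\<psi>\<in>V. \<forall>\<phi>\<in>ortho_compl V. norm \<psi> = 1 \<longrightarrow> norm \<phi> = 1 \<longrightarrow>
           (\<exists>t::real. mean_hitting_time \<Phi> V (pure_state \<phi>) = ereal t \<and>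
              complex_of_real t = trace (block11 V (D \<circ> Z) (pure_state \<psi>)
                                         - block12 V (D \<circ> Z) (pure_state \<phi>)) \<and>
              complex_of_real t = trace (block11 V K (block11 V Z (pure_state \<psi>)
                                                      - block12 V Z (pure_state \<phi>)))))
       \<and> (\<forall>\<psi>\<in>V. \<forall>\<psi>'\<in>V. norm \<psi> = 1 \<longrightarrow> norm \<psi>' = 1 \<longrightarrow>
           trace (block11 V (D \<circ> Z) (pure_state \<psi>)) = trace (block11 V (D \<circ> Z) (pure_state \<psi>')))"
proof -
  interpret hitting_channel \<Phi> V
    using assms by unfold_locales
  have K: "trace (compl_Q_map V (K X)) = trace (G X)" for X
    unfolding assms(9) by (rule trace_compl_hitting_time_map)
  have D: "trace (compl_Q_map V (D X)) = trace (G (compl_Q_map V X))" for X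
    unfolding assms(9,10) by (rule trace_compl_block_diag)
  \<comment> \<open>The Q part of the state vanishes, so the value does not involve the vector; this
    already contains the independence claim.\<close>
  have \<psi>: "trace (G (compl_Q_map V (Z (pure_state \<psi>)))) = 1 + trace (G (Q_map V \<pi>))"
    if "\<psi> \<in> V" "norm \<psi> = 1" for \<psi>
  proof -
    have "G 0 = 0" by (rule linear_0[OF linear_cmap_imp_linear[OF linear_G]])
    then show ?thesis
      using trace_G_identity[of "pure_state \<psi>"] Q_map_pure_state(1)[OF assms(5) that(1)]
        pure_state_density[OF that(2)]
      by (simp add: assms(8) density_matrix_def trace_def algebra_simps)
  qed
  have block11: "compl_Q_map V (pure_state \<psi>) = pure_state \<psi>" if "\<psi> \<in> V" for \<psi>
    using Q_map_pure_state(1)[OF assms(5) that] by (simp add: compl_Q_map_def)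
  show ?thesis
  proof (intro conjI ballI impI)
    fix \<psi> \<phi> assume \<psi>V: "\<psi> \<in> V" "norm \<psi> = 1" and \<phi>: "\<phi> \<in> ortho_compl V" "norm \<phi> = 1"
    have dens: "density_matrix (pure_state \<phi>)" using \<phi>(2) by (rule pure_state_density)
    have Q\<phi>: "Q_map V (pure_state \<phi>) = pure_state \<phi>" by (rule Q_map_pure_state(2)[OF assms(5) \<phi>(1)])
    let ?t = "Re (trace (G (pure_state \<phi>)))"
    have "complex_of_real ?t = trace (G (pure_state \<phi>))"
      using trace_G_real[of "pure_state \<phi>"] dens
      by (simp add: density_matrix_def pos_semidef_hermitian)
    \<comment> \<open>The constant Tr(G Q \<pi>) is eliminated by expressing it through the state on
      V.\<close>
    also have "\<dots> = trace (G (compl_Q_map V (Z (pure_state \<psi>))))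
        - trace (G (compl_Q_map V (Z (pure_state \<phi>))))"
      using trace_G_identity[of "pure_state \<phi>"] dens
      by (simp add: \<psi>[OF \<psi>V, unfolded assms(8)] Q\<phi> assms(8) density_matrix_def algebra_simps)
    finally have t: "complex_of_real ?t = \<dots>" .
    show "\<exists>t::real. mean_hitting_time \<Phi> V (pure_state \<phi>) = ereal t \<and>
              complex_of_real t = trace (block11 V (D \<circ> Z) (pure_state \<psi>)
                                         - block12 V (D \<circ> Z) (pure_state \<phi>)) \<and>
              complex_of_real t = trace (block11 V K (block11 V Z (pure_state \<psi>)
                                                      - block12 V Z (pure_state \<phi>)))"
    proof (intro exI conjI)
      show "mean_hitting_time \<Phi> V (pure_state \<phi>) = ereal ?t" using dens by (rule mean_hitting_time_eq)
    \<comment> \<open>Both expressions collapse to the difference of the traces of G(I - Q)Z at the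
      two states, the second one by idempotence of I - Q.\<close>
    qed (simp_all add: t block11_def block12_def trace_sub block11[OF \<psi>V(1)] Q\<phi> K D
        compl_Q_map_simps linear_cmap_diff[OF linear_G])
  next
    fix \<psi> \<psi>' assume "\<psi> \<in> V" "\<psi>' \<in> V" "norm \<psi> = 1" "norm \<psi>' = 1"
    then show "trace (block11 V (D \<circ> Z) (pure_state \<psi>)) = trace (block11 V (D \<circ> Z) (pure_state \<psi>'))"
      by (simp add: block11_def block11 D \<psi>)
  qed
qed

end
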